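(* Let $n \ge 6$. Then every biconnected digraph $D=(V,A)$ of order $n$ and outradius $3$ satisfies $\lvert A \rvert \le (n-2)^2$. Equality holds if and only if $D \cong D_{n,3,s}$ for some integer $s$ with $1 \le s \le \frac{n-4}{2}$.
   Context: Digraphs are finite, without loops or multiple arcs (both arcs $\vec{uv}$ and $\vec{vu}$ may be present). $d(u,v)$ is the length of a shortest directed path from $u$ to $v$ ($+\infty$ if none). The out-eccentricity of $v$ is $\mathrm{ecc}^+(v)=\max_{u\in V} d(v,u)$ and the outradius is $\mathrm{rad}^+(D)=\min_{v\in V}\mathrm{ecc}^+(v)$. A digraph is biconnected (strongly connected) if $d(u,v)$ is finite for all $u,v$. The size is $\lvert A\rvert$. For $r\ge 1$, $D_{2r,r,1}$ is the digraph with vertex set $\{v_1,\dots,v_r\}\cup\{w_1,\dots,w_r\}$ and arc set $\{\vec{v_iv_j} : i\ne j,\ i\ge j-1\}\cup\{\vec{w_iw_j} : i\ne j,\ i\ge j-1\}\cup\{\vec{v_iw_1}: 1\le i\le r\}\cup\{\vec{w_iv_1}: 1\le i\le r\}$. For $n\ge 2r$ and $1\le s\le \frac{n-2r+2}{2}$, $D_{n,r,s}$ is obtained from $D_{2r,r,1}$ by replacing $v_1$ by a bidirected clique on $s$ vertices and $w_1$ by a bidirected clique on $n-2r+2-s$ vertices (blow-up): every arc between $v_1$ (resp. $w_1$) and another vertex $x$ is replaced by arcs in the same direction between every vertex of the corresponding clique and $x$, and since $v_1,w_1$ are joined in both directions, all vertices of the two cliques are joined in both directions. *)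

theory Defs
  imports "Graph_Theory.Graph_Theory" "HOL-Library.Extended_Nat"
begin

text \<open>
  Digraphs without loops or multiple arcs are modelled by the locale \<^locale>\<open>digraph\<close> of the
  AFP entry \<open>Graph_Theory\<close>, whose digraphs are finite.
\<close>

subsection \<open>Distance, eccentricity and radius\<close>

text \<open>The infimum over the empty set is \<^term>\<open>\<infinity> :: enat\<close>, so \<open>dist_to\<close> is infinite when there is no
  path.\<close>

definition dist_to :: "('a, 'b) pre_digraph \<Rightarrow> 'a \<Rightarrow> 'a \<Rightarrow> enat" where
  "dist_to G u v = (INF p\<in>{p. pre_digraph.apath G u p v}. enat (length p))"

definition out_ecc :: "('a, 'b) pre_digraph \<Rightarrow> 'a \<Rightarrow> enat" where
  "out_ecc G v = (MAX u\<in>verts G. dist_to G v u)"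

definition outradius :: "('a, 'b) pre_digraph \<Rightarrow> enat" where
  "outradius G = (MIN v\<in>verts G. out_ecc G v)"

definition biconnected :: "('a, 'b) pre_digraph \<Rightarrow> bool" where
  "biconnected G \<longleftrightarrow> (\<forall>u\<in>verts G. \<forall>v\<in>verts G. dist_to G u v \<noteq> \<infinity>)"

lemma (in wf_digraph) dist_to_finite_iff: "dist_to G u v \<noteq> \<infinity> \<longleftrightarrow> u \<rightarrow>\<^sup>* v"
proof
  assume "dist_to G u v \<noteq> \<infinity>"
  then have "{p. apath u p v} \<noteq> {}"
    unfolding dist_to_def by (metis image_empty Inf_empty top_enat_def)
  then show "u \<rightarrow>\<^sup>* v"
    by (auto simp: reachable_apath)
next
  assume "u \<rightarrow>\<^sup>* v"
  then obtain p where "apath u p v"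
    by (auto simp: reachable_apath)
  then have "dist_to G u v \<le> enat (length p)"
    unfolding dist_to_def by (auto intro: INF_lower)
  then show "dist_to G u v \<noteq> \<infinity>"
    by (metis enat_ord_simps(5) enat.distinct(1))
qed

lemma (in wf_digraph) biconnected_iff_strongly_connected:
  "verts G \<noteq> {} \<Longrightarrow> biconnected G \<longleftrightarrow> strongly_connected G"
  unfolding biconnected_def strongly_connected_def dist_to_finite_iff by simp


subsection \<open>The extremal digraphs\<close>

datatype base_vertex = Vx nat | Wx nat

text \<open>The digraph $D_{2r,r,1}$, with \<open>Vx i\<close> for $v_i$ and \<open>Wx i\<close> for $w_i$.\<close>

definition base_digraph :: "nat \<Rightarrow> base_vertex pair_pre_digraph" where
  "base_digraph r = \<lparr>
     pverts = Vx ` {1..r} \<union> Wx ` {1..r},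
     parcs = {(Vx i, Vx j) | i j. i \<in> {1..r} \<and> j \<in> {1..r} \<and> i \<noteq> j \<and> i + 1 \<ge> j}
           \<union> {(Wx i, Wx j) | i j. i \<in> {1..r} \<and> j \<in> {1..r} \<and> i \<noteq> j \<and> i + 1 \<ge> j}
           \<union> {(Vx i, Wx 1) | i. i \<in> {1..r}}
           \<union> {(Wx i, Vx 1) | i. i \<in> {1..r}} \<rparr>"

text \<open>Every vertex \<open>x\<close> is replaced by a bidirected clique on \<open>m x\<close> vertices \<open>(x, 0), \<dots>, (x, m x - 1)\<close>;
  vertices with \<open>m x = 1\<close> are left unchanged.\<close>

definition clique_blowup :: "'a pair_pre_digraph \<Rightarrow> ('a \<Rightarrow> nat) \<Rightarrow> ('a \<times> nat) pair_pre_digraph" where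
  "clique_blowup G m = \<lparr>
     pverts = {(x, i). x \<in> pverts G \<and> i < m x},
     parcs = {((x, i), (y, j)) | x i y j. (x, y) \<in> parcs G \<and> i < m x \<and> j < m y}
           \<union> {((x, i), (x, j)) | x i j. x \<in> pverts G \<and> i < m x \<and> j < m x \<and> i \<noteq> j} \<rparr>"

text \<open>$D_{n,r,s}$, meaningful for $r \ge 1$, $n \ge 2r$ and $1 \le s \le (n-2r+2)/2$; in this range the
  truncated subtraction gives the clique size $n-2r+2-s$.\<close>

definition extremal_digraph :: "nat \<Rightarrow> nat \<Rightarrow> nat \<Rightarrow> (base_vertex \<times> nat) pair_pre_digraph" where
  "extremal_digraph n r s =
     clique_blowup (base_digraph r) ((\<lambda>_. 1)(Vx 1 := s, Wx 1 := n + 2 - 2 * r - s))"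

lemma digraph_extremal: "digraph (with_proj (extremal_digraph n r s))"
proof -
  let ?m = "(\<lambda>_. 1)(Vx 1 := s, Wx 1 := n + 2 - 2 * r - s)"
  let ?G = "extremal_digraph n r s"
  have V: "pverts ?G \<subseteq> (SIGMA x:pverts (base_digraph r). {..<?m x})"
    by (auto simp: extremal_digraph_def clique_blowup_def)
  have fin: "finite (pverts ?G)"
    by (rule finite_subset[OF V]) (auto simp: base_digraph_def)
  have A: "parcs ?G \<subseteq> pverts ?G \<times> pverts ?G"
    unfolding extremal_digraph_def clique_blowup_def base_digraph_def by auto
  have "finite (parcs ?G)"
    by (rule finite_subset[OF A]) (use fin in auto)
  moreover have "fst e \<noteq> snd e" if "e \<in> parcs ?G" for e
    using that unfolding extremal_digraph_def clique_blowup_def base_digraph_def by auto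
  ultimately show ?thesis
    using fin A by unfold_locales (auto simp: arc_to_ends_def)
qed

end

theory Submission
  imports Defs
begin

text \<open>
  Count the non-arcs: with \<open>M v\<close> the set of vertices \<open>u \<noteq> v\<close> that are not out-neighbours of \<open>v\<close>, the
  claim is that the sizes of the \<open>M v\<close> add up to at least \<open>3n - 4\<close>. Always \<open>|M v| \<ge> 2\<close>, so it suffices to
  study the set \<open>T\<close> of vertices with \<open>|M v| = 2\<close>, which must have at least four elements if the sum is at
  most \<open>3n - 4\<close>. If \<open>M v = {a, b}\<close> with \<open>b\<close> at distance 3 from \<open>v\<close>, then \<open>a\<close> is the only in-neighbour of
  \<open>b\<close>. Let \<open>B\<close> be the set of these vertices \<open>b\<close>. Four vertices of in-degree 1 already lack too many
  arcs; if \<open>|B| = 3\<close>, every \<open>b\<close> belongs to a single \<open>v\<close>, so \<open>|T| \<le> 3\<close>. If \<open>|B| = 1\<close>, or if \<open>B = {b, d}\<close> where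
  one of the two is the in-neighbour of the other, then some vertex has no arc into \<open>T\<close>, and this alone
  makes the sum too large. In the remaining case \<open>T\<close> consists of \<open>b\<close>, \<open>d\<close> and their in-neighbours, every
  other vertex misses exactly three vertices, and the digraph is determined up to the sizes of the two
  cliques.
\<close>

section \<open>Non-out-neighbourhoods and the shape of the extremal digraphs\<close>

definition nonout :: "'a set \<Rightarrow> ('a \<Rightarrow> 'a \<Rightarrow> bool) \<Rightarrow> 'a \<Rightarrow> 'a set" where
  "nonout V R v = {u \<in> V. u \<noteq> v \<and> \<not> R v u}"

text \<open>In $D_{n,3,s}$ the cliques replacing $v_1$ and $w_1$ are \<open>X\<close> and \<open>Y\<close>, and \<open>a\<close>, \<open>b\<close>, \<open>c\<close>, \<open>d\<close> are
  $v_2$, $v_3$, $w_2$, $w_3$.\<close>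

definition double_chain ::
  "'a set \<Rightarrow> ('a \<Rightarrow> 'a \<Rightarrow> bool) \<Rightarrow> 'a set \<Rightarrow> 'a set \<Rightarrow> 'a \<Rightarrow> 'a \<Rightarrow> 'a \<Rightarrow> 'a \<Rightarrow> bool" where
  "double_chain V R X Y a b c d \<longleftrightarrow>
     V = X \<union> Y \<union> {a, b, c, d} \<and> X \<inter> Y = {} \<and> distinct [a, b, c, d] \<and> (X \<union> Y) \<inter> {a, b, c, d} = {} \<and>
     (\<forall>v\<in>X. nonout V R v = {b, c, d}) \<and> (\<forall>v\<in>Y. nonout V R v = {a, b, d}) \<and>
     nonout V R a = {c, d} \<and> nonout V R b = {c, d} \<and>
     nonout V R c = {a, b} \<and> nonout V R d = {a, b}"

text \<open>The two halves play symmetric roles; this allows the smaller clique to be taken as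
  \<open>X\<close>, which gives the upper bound on \<open>s\<close>.\<close>

lemma double_chain_swap: "double_chain V R X Y a b c d \<Longrightarrow> double_chain V R Y X c d a b"
  unfolding double_chain_def by auto

lemma double_chainD:
  assumes "double_chain V R X Y a b c d"
  shows "v \<in> X \<Longrightarrow> nonout V R v = {b, c, d}" "v \<in> Y \<Longrightarrow> nonout V R v = {a, b, d}"
    "nonout V R a = {c, d}" "nonout V R b = {c, d}" "nonout V R c = {a, b}" "nonout V R d = {a, b}"
  using assms unfolding double_chain_def by - (elim conjE, (drule (1) bspec)?, assumption)+

text \<open>Every clique vertex misses three vertices and each of \<open>a\<close>,
  \<open>b\<close>, \<open>c\<close>, \<open>d\<close> misses two, so four are saved against
  \<open>3 * card V\<close>.\<close>

lemma sum_card_nonout_double_chain: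
  assumes "double_chain V R X Y a b c d" "finite V"
  shows "(\<Sum>v\<in>V. card (nonout V R v)) + 4 = 3 * card V"
    and "card V = card X + card Y + 4"
proof -
  have fin: "finite X" "finite Y"
    using assms unfolding double_chain_def by auto
  have V: "V = X \<union> (Y \<union> {a, b, c, d})" and disj: "X \<inter> (Y \<union> {a, b, c, d}) = {}" "Y \<inter> {a, b, c, d} = {}"
    and ne: "a \<noteq> b" "a \<noteq> c" "a \<noteq> d" "b \<noteq> c" "b \<noteq> d" "c \<noteq> d"
    using assms(1) unfolding double_chain_def by auto
  have N: "nonout V R a = {c, d}" "nonout V R b = {c, d}" "nonout V R c = {a, b}" "nonout V R d = {a, b}"
    and NX: "\<And>v. v \<in> X \<Longrightarrow> card (nonout V R v) = 3" and NY: "\<And>v. v \<in> Y \<Longrightarrow> card (nonout V R v) = 3"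
    using assms(1) ne unfolding double_chain_def by auto
  let ?f = "\<lambda>v. card (nonout V R v)"
  have "sum ?f (X \<union> (Y \<union> {a, b, c, d})) = sum ?f X + (sum ?f Y + sum ?f {a, b, c, d})"
    using fin disj by (simp only: sum.union_disjoint finite_Un finite.intros)
  also have "sum ?f {a, b, c, d} = 8"
    using ne N by simp
  finally have S: "sum ?f V = 3 * card X + (3 * card Y + 8)"
    unfolding V[symmetric] using NX NY by simp
  have "card (X \<union> (Y \<union> {a, b, c, d})) = card X + (card Y + card {a, b, c, d})"
    using fin disj by (simp only: card_Un_disjoint finite_Un finite.intros)
  then show C: "card V = card X + card Y + 4"
    unfolding V[symmetric] using ne by simp
  show "sum ?f V + 4 = 3 * card V"
    using S C by simp
qed

text \<open>Only \<open>a\<close>, \<open>b\<close>, \<open>c\<close>, \<open>d\<close> are ever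
  missed, and what a vertex misses depends only on its block. Hence arbitrary bijections between the
  cliques extend to an isomorphism, and the sizes of \<open>X\<close> and \<open>Y\<close> determine
  the digraph.\<close>

lemma double_chain_iso:
  assumes A: "double_chain V R X Y a b c d" and B: "double_chain V' R' X' Y' a' b' c' d'"
    and fin: "finite V" "finite V'" and card: "card X = card X'" "card Y = card Y'"
    and irrefl: "\<And>v. \<not> R v v" "\<And>v. \<not> R' v v"
  obtains f where "bij_betw f V V'" "\<And>u v. u \<in> V \<Longrightarrow> v \<in> V \<Longrightarrow> R' (f u) (f v) \<longleftrightarrow> R u v"
proof -
  have "finite X" "finite Y" "finite X'" "finite Y'"
    using A B fin unfolding double_chain_def by auto
  then obtain g h where g: "bij_betw g X X'" and h: "bij_betw h Y Y'"
    using card by (meson finite_same_card_bij)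
  define f where "f v = (if v \<in> X then g v else if v \<in> Y then h v
    else if v = a then a' else if v = b then b' else if v = c then c' else d')" for v
  have V: "V = X \<union> Y \<union> {a, b, c, d}" "V' = X' \<union> Y' \<union> {a', b', c', d'}"
    using A B unfolding double_chain_def by blast+
  have fX: "f v = g v" if "v \<in> X" for v using that by (simp add: f_def)
  have fY: "f v = h v" if "v \<in> Y" for v
    using that A unfolding double_chain_def by (auto simp: f_def)
  have f4: "f a = a'" "f b = b'" "f c = c'" "f d = d'"
    using A unfolding double_chain_def by (auto simp: f_def)
  have bX: "bij_betw f X X'" and bY: "bij_betw f Y Y'"
    using g h fX fY by (simp_all cong: bij_betw_cong)
  have b4: "bij_betw f {a, b, c, d} {a', b', c', d'}"
    using A B unfolding double_chain_def by (auto simp: bij_betw_def f4)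
  have bij: "bij_betw f V V'"
  proof -
    have "X \<inter> Y = {}" "X' \<inter> Y' = {}" "(X' \<union> Y') \<inter> {a', b', c', d'} = {}"
      using A B unfolding double_chain_def by auto
    then show ?thesis
      unfolding V by (intro bij_betw_combine bX bY b4)
  qed
  have N: "nonout V' R' (f u) = f ` nonout V R u" if u: "u \<in> V" for u
  proof -
    consider "u \<in> X" | "u \<in> Y" | "u \<in> {a, b, c, d}" using u V(1) by auto
    then show ?thesis
    proof cases
      case 1
      moreover have "f u \<in> X'" using 1 bX by (auto dest: bij_betwE)
      ultimately show ?thesis using f4 double_chainD(1)[OF A] double_chainD(1)[OF B] by simp
    next
      case 2
      moreover have "f u \<in> Y'" using 2 bY by (auto dest: bij_betwE)
      ultimately show ?thesis using f4 double_chainD(2)[OF A] double_chainD(2)[OF B] by simp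
    next
      case 3
      then show ?thesis using f4 double_chainD(3-6)[OF A] double_chainD(3-6)[OF B] by auto
    qed
  qed
  have "R' (f u) (f v) \<longleftrightarrow> R u v" if uv: "u \<in> V" "v \<in> V" for u v
  proof (cases "u = v")
    case True
    then show ?thesis using irrefl by simp
  next
    case False
    have inj: "inj_on f V" and im: "f v \<in> V'" using bij uv by (auto simp: bij_betw_def)
    have "f v \<noteq> f u" using False inj uv by (auto dest: inj_onD)
    have "R' (f u) (f v) \<longleftrightarrow> f v \<notin> nonout V' R' (f u)"
      using \<open>f v \<noteq> f u\<close> im by (simp add: nonout_def)
    also have "\<dots> \<longleftrightarrow> v \<notin> nonout V R u"
      unfolding N[OF uv(1)] using inj uv by (subst inj_on_image_mem_iff[OF inj]) (auto simp: nonout_def)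
    finally show ?thesis using False uv by (simp add: nonout_def)
  qed
  then show thesis using that bij by blast
qed

text \<open>The ordered pairs of distinct vertices split into arcs and non-arcs, the latter grouped
  by their tails.\<close>

lemma card_arcs_plus_nonout:
  assumes "finite V" "E \<subseteq> V \<times> V" "\<And>v. (v, v) \<notin> E"
  shows "card E + (\<Sum>v\<in>V. card (nonout V (\<lambda>u v. (u, v) \<in> E) v)) = card V * (card V - 1)"
proof -
  let ?N = "nonout V (\<lambda>u v. (u, v) \<in> E)"
  have "finite E" using assms finite_subset by blast
  have fN: "finite (?N v)" for v using assms(1) by (simp add: nonout_def)
  have S: "(SIGMA v:V. V - {v}) = E \<union> (SIGMA v:V. ?N v)"
    using assms by (auto simp: nonout_def)
  have "card (SIGMA v:V. V - {v}) = card E + card (SIGMA v:V. ?N v)"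
    unfolding S by (rule card_Un_disjoint) (use \<open>finite E\<close> fN assms(1) in \<open>auto simp: nonout_def\<close>)
  then show ?thesis
    using assms(1) fN by (simp add: card_SigmaI)
qed

section \<open>Lower bound for the number of non-arcs\<close>

text \<open>Distances and paths are eliminated here: \<open>far\<close> says that every
  out-eccentricity is at least 3, and \<open>enter\<close> is strong connectedness in terms of
  cuts.\<close>

locale outradius_ge_3 =
  fixes V :: "'a set" and R :: "'a \<Rightarrow> 'a \<Rightarrow> bool"
  assumes finite_V: "finite V"
    and card_V: "card V \<ge> 6"
    and irrefl: "\<not> R v v"
    and far: "v \<in> V \<Longrightarrow> \<exists>u\<in>V. u \<noteq> v \<and> \<not> R v u \<and> (\<forall>w\<in>V. R v w \<longrightarrow> \<not> R w u)"
    and enter: "S \<subseteq> V \<Longrightarrow> S \<noteq> {} \<Longrightarrow> S \<noteq> V \<Longrightarrow> \<exists>x\<in>V - S. \<exists>y\<in>S. R x y"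
begin

abbreviation "M \<equiv> nonout V R"

definition T :: "'a set" where
  "T = {v \<in> V. card (M v) = 2}"

definition leaf :: "'a \<Rightarrow> 'a \<Rightarrow> bool" where
  "leaf a b \<longleftrightarrow> a \<in> V \<and> b \<in> V \<and> a \<noteq> b \<and> R a b \<and> (\<forall>x\<in>V. R x b \<longrightarrow> x = a)"

text \<open>The shape forced on members of \<open>T\<close>: \<open>b\<close> is at distance at
  least 3 from \<open>v\<close> because \<open>v\<close> also misses the only in-neighbour of
  \<open>b\<close>.\<close>

definition tight :: "'a \<Rightarrow> 'a \<Rightarrow> 'a \<Rightarrow> bool" where
  "tight v a b \<longleftrightarrow> v \<in> V \<and> leaf a b \<and> M v = {a, b}"

lemma finite_M [simp]: "finite (M v)"
  using finite_V by (simp add: nonout_def)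

lemma finite_T [simp]: "finite T"
  using finite_V by (simp add: T_def)

lemma not_all_small: "card S < 6 \<Longrightarrow> S \<noteq> V"
  using card_V by auto

text \<open>If \<open>u\<close> is at distance at least 3 from \<open>v\<close>, then
  \<open>v\<close> misses all in-neighbours of \<open>u\<close> as well, and \<open>enter\<close>
  applied to \<open>{u}\<close> supplies one.\<close>

lemma far_pair:
  assumes "v \<in> V"
  obtains u x where "u \<in> M v" "x \<in> M v" "x \<noteq> u" "R x u" "\<And>y. y \<in> V \<Longrightarrow> R y u \<Longrightarrow> y \<in> M v"
proof -
  obtain u where u: "u \<in> V" "u \<noteq> v" "\<not> R v u" "\<And>w. w \<in> V \<Longrightarrow> R v w \<Longrightarrow> \<not> R w u"
    using far[OF assms] by blast
  obtain x where x: "x \<in> V - {u}" "R x u"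
    using enter[of "{u}"] not_all_small[of "{u}"] u(1) by auto
  show thesis
  proof (rule that)
    show "u \<in> M v" using u by (simp add: nonout_def)
    show in_M: "y \<in> M v" if "y \<in> V" "R y u" for y
      using that u by (auto simp: nonout_def)
    show "x \<in> M v" "x \<noteq> u" "R x u" using x in_M by auto
  qed
qed

lemma card_M_ge_2: "v \<in> V \<Longrightarrow> card (M v) \<ge> 2"
proof (erule far_pair)
  fix u x assume "u \<in> M v" "x \<in> M v" "x \<noteq> u"
  then have "card {u, x} \<le> card (M v)" by (intro card_mono) auto
  then show "card (M v) \<ge> 2" using \<open>x \<noteq> u\<close> by simp
qed

lemma T_tight:
  assumes "v \<in> T"
  obtains a b where "tight v a b"
proof -
  have v: "v \<in> V" "card (M v) = 2" using assms by (auto simp: T_def)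
  obtain u x where ux: "u \<in> M v" "x \<in> M v" "x \<noteq> u" "R x u" "\<And>y. y \<in> V \<Longrightarrow> R y u \<Longrightarrow> y \<in> M v"
    using far_pair[OF v(1)] by metis
  have "M v = {x, u}"
    using ux v(2) by (intro card_seteq[symmetric]) auto
  moreover have "leaf x u"
    unfolding leaf_def using ux calculation irrefl by (auto simp: nonout_def)
  ultimately show thesis using that v by (simp add: tight_def)
qed

lemma leaf_unique: "leaf a b \<Longrightarrow> leaf a' b \<Longrightarrow> a = a'"
  by (auto simp: leaf_def)

lemma leaf_no_2_cycle: "leaf a b \<Longrightarrow> \<not> leaf b a"
proof
  assume ab: "leaf a b" "leaf b a"
  have "card {a, b} < 6" by (cases "a = b") auto
  then show False
    using enter[of "{a, b}"] not_all_small ab by (auto simp: leaf_def)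
qed

text \<open>If \<open>v\<close> differs from \<open>b'\<close> and does not miss it, then
  \<open>v\<close> is its only in-neighbour \<open>a'\<close>. If \<open>v\<close> misses
  \<open>b'\<close>, then \<open>b'\<close> is \<open>a\<close>, the other missed vertex being
  \<open>b\<close>.\<close>

lemma tight_leaf:
  assumes "tight v a b" "leaf a' b'" "b' \<noteq> b"
  shows "v = b' \<or> v = a' \<or> b' = a"
  using assms unfolding tight_def leaf_def by (auto simp: nonout_def set_eq_iff)

lemma tight_not_self: "tight v a b \<Longrightarrow> v \<noteq> a \<and> v \<noteq> b"
  by (auto simp: tight_def nonout_def)

lemma tight_not_pred: "tight v a b \<Longrightarrow> leaf a' b' \<Longrightarrow> b' = a \<Longrightarrow> v \<noteq> a'"
  by (auto simp: tight_def leaf_def nonout_def set_eq_iff)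

text \<open>The case of \<open>tight_unique\<close> in which the in-neighbour \<open>a\<close> of
  \<open>b\<close> has in-degree 1 itself. If \<open>u\<close> and \<open>v\<close> differed, they
  would be \<open>b3\<close> and \<open>a3\<close>; then \<open>v2\<close> would have to be
  \<open>b\<close>, which cannot be reconciled with the leaf \<open>b3\<close>.\<close>

lemma tight_unique_aux:
  assumes t: "tight u a b" "tight v a b" "tight v2 a2 a" "tight v3 a3 b3"
    and ne: "b \<noteq> b3" "a \<noteq> b3"
  shows "u = v"
proof (rule ccontr)
  assume "u \<noteq> v"
  have L: "leaf a b" "leaf a2 a" "leaf a3 b3" using t by (auto simp: tight_def)
  have "u = b3 \<or> u = a3" "v = b3 \<or> v = a3"
    using tight_leaf[OF t(1) L(3)] tight_leaf[OF t(2) L(3)] ne by blast+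
  then have uv: "{u, v} = {b3, a3}" using \<open>u \<noteq> v\<close> by blast
  have "a2 \<notin> {u, v}" "a \<notin> {u, v}" "b \<notin> {u, v}"
    using t(1,2)[THEN tight_not_self] tight_not_pred[OF t(1) L(2)] tight_not_pred[OF t(2) L(2)] by blast+
  then have a2: "a2 \<noteq> b3" and a3: "a3 \<noteq> b" unfolding uv by blast+
  have "b \<noteq> a" "b \<noteq> a2" using L leaf_no_2_cycle by (auto simp: leaf_def)
  then have "v2 = b" using tight_leaf[OF t(3) L(1)] tight_not_self[OF t(3)] by blast
  then show False using tight_leaf[OF t(3) L(3)] ne a2 a3 by blast
qed

text \<open>Used when there are three possible far vertices, to show that each belongs to a single
  member of \<open>T\<close>.\<close>

lemma tight_unique:
  assumes t: "tight u a1 b1" "tight v a1 b1" "tight v2 a2 b2" "tight v3 a3 b3"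
    and ne: "b1 \<noteq> b2" "b1 \<noteq> b3" "b2 \<noteq> b3"
  shows "u = v"
proof -
  have L: "leaf a2 b2" "leaf a3 b3" using t by (auto simp: tight_def)
  consider "a1 = b2" | "a1 = b3" | "a1 \<noteq> b2" "a1 \<noteq> b3" by blast
  then show ?thesis
  proof cases
    case 1
    then show ?thesis using tight_unique_aux[of u a1 b1 v v2 a2 v3 a3 b3] t ne by blast
  next
    case 2
    then show ?thesis using tight_unique_aux[of u a1 b1 v v3 a3 v2 a2 b2] t ne by blast
  next
    \<comment> \<open>Both \<open>u\<close> and \<open>v\<close> lie in \<open>{b2, a2}\<close> and
      in \<open>{b3, a3}\<close>. These sets share at most one element, since they could only
      coincide through a forbidden 2-cycle of leaves.\<close>
    case 3
    have "u = b2 \<or> u = a2" "u = b3 \<or> u = a3" "v = b2 \<or> v = a2" "v = b3 \<or> v = a3"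
      using tight_leaf[OF t(1) L(1)] tight_leaf[OF t(1) L(2)]
        tight_leaf[OF t(2) L(1)] tight_leaf[OF t(2) L(2)] ne 3 by blast+
    moreover have "\<not> (a2 = b3 \<and> a3 = b2)" using L leaf_no_2_cycle by blast
    ultimately show ?thesis using ne by blast
  qed
qed

text \<open>The summand is the termwise lower bound for \<open>card (M v)\<close>: 2 on
  \<open>T\<close> and 3 elsewhere.\<close>

lemma sum_default: "(\<Sum>v\<in>V. if v \<in> T then 2 else 3) + card T = 3 * card V"
proof -
  have T: "T \<subseteq> V" by (auto simp: T_def)
  have "card T = (\<Sum>v\<in>V. if v \<in> T then 1 else 0 :: nat)"
    using finite_V T by (simp add: sum.If_cases Int_absorb1)
  then have "(\<Sum>v\<in>V. if v \<in> T then 2 else 3) + card T =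
      (\<Sum>v\<in>V. (if v \<in> T then 2 else 3) + (if v \<in> T then 1 else 0 :: nat))"
    by (simp add: sum.distrib)
  also have "\<dots> = (\<Sum>v\<in>V. 3)" by (intro sum.cong) auto
  finally show ?thesis by simp
qed

lemma default_le: "v \<in> V \<Longrightarrow> (if v \<in> T then 2 else 3) \<le> card (M v)"
  using card_M_ge_2[of v] by (auto simp: T_def)

lemma sum_ge_default: "(\<Sum>v\<in>V. card (M v)) + card T \<ge> 3 * card V"
  using sum_mono[of V "\<lambda>v. if v \<in> T then 2 else 3" "\<lambda>v. card (M v)"] default_le sum_default
  by auto

text \<open>Such an \<open>x\<close> lies outside \<open>T\<close> and exceeds its default value 3
  by at least \<open>card T - 3\<close>, which cancels all but 3 of the saving
  \<open>card T\<close>.\<close>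

lemma sum_ge_of_large:
  assumes "x \<in> V" "card (M x) \<ge> card T" "card T \<ge> 3"
  shows "(\<Sum>v\<in>V. card (M v)) + 3 \<ge> 3 * card V"
proof -
  let ?g = "\<lambda>v. if v \<in> T then 2 else 3 :: nat"
  have x: "x \<notin> T" using assms by (auto simp: T_def)
  have "(\<Sum>v\<in>V. card (M v)) = card (M x) + (\<Sum>v\<in>V - {x}. card (M v))"
    using assms(1) finite_V by (simp add: sum.remove)
  moreover have "(\<Sum>v\<in>V - {x}. card (M v)) \<ge> sum ?g (V - {x})"
    using default_le by (intro sum_mono) auto
  moreover have "sum ?g V = 3 + sum ?g (V - {x})"
    using assms(1) finite_V x by (simp add: sum.remove)
  ultimately show ?thesis using sum_default assms(2) by linarith
qed

text \<open>Non-arcs are counted by their heads: a vertex of in-degree 1 is missed by all vertices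
  except itself and its in-neighbour.\<close>

lemma sum_ge_leaves:
  assumes "finite B" "\<And>b. b \<in> B \<Longrightarrow> \<exists>a. leaf a b"
  shows "(\<Sum>v\<in>V. card (M v)) \<ge> card B * (card V - 2)"
proof -
  obtain p where p: "\<And>b. b \<in> B \<Longrightarrow> leaf (p b) b" using assms(2) by metis
  have fin: "finite (V - {b, p b})" for b using finite_V by simp
  have c: "card (V - {b, p b}) = card V - 2" if "b \<in> B" for b
    using p[OF that] finite_V by (subst card_Diff_subset) (auto simp: leaf_def)
  have "card B * (card V - 2) = card (SIGMA b:B. V - {b, p b})"
    using assms(1) fin c by (simp add: card_SigmaI)
  also have "\<dots> \<le> card (SIGMA v:V. M v)"
  proof (rule card_inj_on_le)
    show "prod.swap ` (SIGMA b:B. V - {b, p b}) \<subseteq> (SIGMA v:V. M v)"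
      using p unfolding leaf_def nonout_def by fastforce
  qed (use finite_V in auto)
  finally show ?thesis using finite_V by (simp add: card_SigmaI)
qed

text \<open>An arc from \<open>x\<close> to some \<open>t\<close> would bring every vertex within
  two steps of \<open>x\<close>: \<open>t\<close> misses only \<open>a\<close> and \<open>b\<close>,
  and these are reached along \<open>x\<close>, \<open>a\<close>, \<open>b\<close>. This contradicts
  \<open>far\<close>.\<close>

lemma large_of_entering:
  assumes x: "x \<in> V" and two: "R x a" "R a b"
    and T': "\<And>t. t \<in> T' \<Longrightarrow> tight t a b"
  shows "T' \<subseteq> M x"
proof
  fix t assume t: "t \<in> T'"
  then have tt: "t \<in> V" "M t = {a, b}" and ab: "a \<in> V" "leaf a b" using T' by (auto simp: tight_def leaf_def)
  have "\<not> R x t"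
  proof
    assume xt: "R x t"
    obtain u where u: "u \<in> V" "u \<noteq> x" "\<not> R x u" "\<And>w. w \<in> V \<Longrightarrow> R x w \<Longrightarrow> \<not> R w u"
      using far[OF x] by blast
    have "u = t \<or> R t u \<or> u = a \<or> u = b"
      using tt u(1) by (auto simp: nonout_def set_eq_iff)
    then show False using u xt two tt ab by blast
  qed
  moreover have "t \<noteq> x" using two(1) tt irrefl by (auto simp: nonout_def set_eq_iff)
  ultimately show "t \<in> M x" using tt by (simp add: nonout_def)
qed

text \<open>Deriving equality from the upper bound on the sum treats the inequality and the extremal
  case together.\<close>

theorem sum_card_M:
  assumes small: "(\<Sum>v\<in>V. card (M v)) + 4 \<le> 3 * card V"
  shows "(\<Sum>v\<in>V. card (M v)) + 4 = 3 * card V \<and>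
    (\<exists>X Y a b c d. double_chain V R X Y a b c d \<and> X \<noteq> {} \<and> Y \<noteq> {})"
proof -
  have T4: "card T \<ge> 4" using sum_ge_default small by linarith
  define B where "B = {b. \<exists>v a. tight v a b}"
  have "B \<subseteq> V" by (auto simp: B_def tight_def leaf_def)
  then have finB: "finite B" using finite_V finite_subset by blast
  \<comment> \<open>No vertex misses all of \<open>T\<close>, since the sum would then be at least
    \<open>3 * card V - 3\<close>.\<close>
  have large: False if "x \<in> V" "T \<subseteq> M x" for x
    using sum_ge_of_large[OF that(1)] card_mono[OF _ that(2)] T4 small by fastforce
  have B_less_4: "card B < 4"
  \<comment> \<open>With \<open>n = card V\<close>, the value \<open>4 * (n - 2)\<close> exceeds
    \<open>3 * n - 4\<close> by \<open>n - 4\<close>, which is positive.\<close>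
  proof (rule ccontr)
    assume "\<not> card B < 4"
    then have "4 * (card V - 2) \<le> card B * (card V - 2)" by simp
    also have "\<dots> \<le> (\<Sum>v\<in>V. card (M v))"
      by (rule sum_ge_leaves[OF finB]) (auto simp: B_def tight_def)
    finally show False using small card_V by linarith
  qed
  obtain f where f: "\<And>v. v \<in> T \<Longrightarrow> \<exists>a. tight v a (f v)"
  proof -
    have "\<forall>v. \<exists>b. v \<in> T \<longrightarrow> (\<exists>a. tight v a b)" using T_tight by blast
    then show thesis using that by metis
  qed
  have fB: "f ` T \<subseteq> B" using f unfolding B_def by blast
  have "card B \<noteq> 3"
  proof
    assume B3: "card B = 3"
    have "inj_on f T"
    proof (rule inj_onI)
      fix u v assume uv: "u \<in> T" "v \<in> T" "f u = f v"
      obtain a a' where "tight u a (f u)" "tight v a' (f u)" using f uv by metis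
      then have t: "tight u a (f u)" "tight v a (f u)" using leaf_unique by (auto simp: tight_def)
      have "card (B - {f u}) = 2" using B3 fB uv(1) finB by (auto simp: card_Diff_singleton)
      then obtain b2 b3 where b: "B - {f u} = {b2, b3}" "b2 \<noteq> b3" by (auto simp: card_2_iff)
      then have "b2 \<in> B" "b3 \<in> B" "f u \<noteq> b2" "f u \<noteq> b3" by auto
      then show "u = v" using tight_unique[OF t] b(2) unfolding B_def by blast
    qed
    then have "card T \<le> card B" using fB finB by (rule card_inj_on_le)
    then show False using T4 B3 by simp
  qed
  moreover have "card B \<noteq> 0"
    using fB finB T4 by auto
  moreover have "card B \<noteq> 1"
  proof
    assume "card B = 1"
    then obtain b where Bb: "B = {b}" by (auto simp: card_1_singleton_iff)
    then obtain v a where va: "tight v a b" unfolding B_def by blast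
    then have ab: "leaf a b" by (simp add: tight_def)
    have all: "tight t a b" if t: "t \<in> T" for t
    proof -
      obtain a' where "tight t a' (f t)" using f[OF t] by blast
      moreover have "f t = b" using fB t Bb by auto
      ultimately show ?thesis using leaf_unique[OF ab] by (auto simp: tight_def)
    qed
    have "card {a, b} < 6" by (cases "a = b") auto
    \<comment> \<open>The arc entering \<open>{a, b}\<close> must end in \<open>a\<close>, since
      \<open>b\<close> has no in-neighbour other than \<open>a\<close>; so \<open>x\<close> reaches
      \<open>b\<close> through \<open>a\<close> and misses all of \<open>T\<close>.\<close>
    then obtain x where x: "x \<in> V - {a, b}" "R x a \<or> R x b"
      using enter[of "{a, b}"] not_all_small ab by (auto simp: leaf_def)
    then have "R x a" "R a b" "x \<in> V" using ab by (auto simp: leaf_def)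
    then show False using large large_of_entering all by metis
  qed
  ultimately have "card B = 2" using B_less_4 by linarith
  then obtain b d where Bbd: "B = {b, d}" "b \<noteq> d" by (auto simp: card_2_iff)
  then have "b \<in> B" "d \<in> B" by auto
  then obtain v1 a v2 c where v: "tight v1 a b" "tight v2 c d" unfolding B_def by blast
  then have ab: "leaf a b" and cd: "leaf c d" by (auto simp: tight_def)
  have all: "tight t a b \<or> tight t c d" if T: "t \<in> T" for t
  proof -
    obtain a' where t: "tight t a' (f t)" using f[OF T] by blast
    moreover have "f t = b \<or> f t = d" using fB T Bbd by auto
    ultimately show ?thesis using leaf_unique[OF ab] leaf_unique[OF cd] by (auto simp: tight_def)
  qed
  \<comment> \<open>If \<open>p\<close> is the in-neighbour of \<open>q\<close> and \<open>r\<close>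
    that of \<open>p\<close>, then \<open>r\<close> misses all of \<open>T\<close>: vertices tight
    for \<open>q\<close> by \<open>large_of_entering\<close>, and a vertex tight for
    \<open>p\<close> can only be \<open>q\<close>.\<close>
  have chain: False
    if pq: "tight w1 p q" and rp: "tight w2 r p" and pqr: "\<And>t. t \<in> T \<Longrightarrow> tight t p q \<or> tight t r p"
    for w1 w2 p q r
  proof -
    have L: "leaf p q" "leaf r p" using pq rp by (auto simp: tight_def)
    then have "q \<noteq> r" "q \<noteq> p" using leaf_no_2_cycle by (auto simp: leaf_def)
    have "t \<in> M r" if "t \<in> T" for t
      using pqr[OF that]
    proof
      assume "tight t p q"
      then show ?thesis
        using large_of_entering[of r p q "{t. tight t p q}"] L by (auto simp: leaf_def)
    next
      assume t: "tight t r p"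
      have "t = q" using tight_leaf[OF t L(1)] tight_not_self[OF t] \<open>q \<noteq> r\<close> \<open>q \<noteq> p\<close> by blast
      then show ?thesis using L \<open>q \<noteq> r\<close> by (auto simp: leaf_def nonout_def)
    qed
    then show False using large[of r] L by (auto simp: leaf_def)
  qed
  have "a \<noteq> d" using chain[of v1 d b v2 c] v all by blast
  moreover have "b \<noteq> c" using chain[of v2 b d v1 a] v all by blast
  ultimately have ts: "t = c \<or> t = d" if "tight t a b" for t
    using tight_leaf[OF that cd] Bbd(2) by blast
  have ts': "t = a \<or> t = b" if "tight t c d" for t
    using tight_leaf[OF that ab] Bbd(2) \<open>b \<noteq> c\<close> by blast
  \<comment> \<open>\<open>T\<close> has at least four elements, so this inclusion is an equality
    and the four vertices are distinct.\<close>
  have sub: "T \<subseteq> {a, b, c, d}" using all ts ts' by blast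
  have "card {a, b, c, d} \<le> 4" by (simp add: card_insert_if)
  then have T: "T = {a, b, c, d}" and cT: "card T = 4"
    using card_seteq[OF _ sub] card_mono[OF _ sub] T4 by auto
  have ne: "a \<noteq> b" "a \<noteq> c" "a \<noteq> d" "b \<noteq> c" "b \<noteq> d" "c \<noteq> d"
    using cT unfolding T by (auto simp: card_insert_if split: if_splits)
  have tt: "tight a c d" "tight b c d" "tight c a b" "tight d a b"
    using all[of a] all[of b] all[of c] all[of d] ts ts' ne T by auto
  have M4: "M a = {c, d}" "M b = {c, d}" "M c = {a, b}" "M d = {a, b}"
    using tt by (auto simp: tight_def)
  have sum_eq: "(\<Sum>v\<in>V. card (M v)) + 4 = 3 * card V"
    using sum_ge_default small cT by linarith
  have M3: "card (M v) = 3" if "v \<in> V" "v \<notin> T" for v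
  proof -
    have "(\<Sum>v\<in>V. if v \<in> T then 2 else 3) = (\<Sum>v\<in>V. card (M v))"
      using sum_default sum_eq cT by linarith
    \<comment> \<open>Equality of the sums forces equality in each termwise bound.\<close>
    from sum_mono_inv[OF this default_le that(1) finite_V] show ?thesis using that by simp
  qed
  have other: "M v = {b, c, d} \<or> M v = {a, b, d}" if vT: "v \<in> V" "v \<notin> T" for v
  proof -
    have v: "v \<noteq> a" "v \<noteq> b" "v \<noteq> c" "v \<noteq> d" using vT T by auto
    have bd: "b \<in> M v" "d \<in> M v"
      using v vT(1) ab cd by (auto simp: leaf_def nonout_def)
    have "a \<in> M v \<or> c \<in> M v"
    proof (rule ccontr)
      assume "\<not> (a \<in> M v \<or> c \<in> M v)"
      then have R: "R v a" "R v c" using v ab cd by (auto simp: nonout_def leaf_def)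
      obtain u where u: "u \<in> V" "\<not> R v u" "\<And>w. w \<in> V \<Longrightarrow> R v w \<Longrightarrow> \<not> R w u"
        using far[OF vT(1)] by blast
      \<comment> \<open>Since \<open>M a\<close> is \<open>{c, d}\<close>, the far vertex
        \<open>u\<close> would be \<open>c\<close> or \<open>d\<close>, but \<open>v\<close> reaches
        both within two steps through \<open>c\<close>.\<close>
      have "u \<in> M a" using u R ab by (auto simp: nonout_def leaf_def)
      then show False using u R cd M4 by (auto simp: leaf_def)
    qed
    then obtain z where z: "z \<in> M v" "z = a \<or> z = c" by blast
    then have "{z, b, d} = M v"
      using bd M3[OF vT] ne by (intro card_seteq) auto
    then show ?thesis using z(2) by auto
  qed
  define X where "X = {v \<in> V - T. M v = {b, c, d}}"
  define Y where "Y = {v \<in> V - T. M v = {a, b, d}}"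
  have V: "V = X \<union> Y \<union> {a, b, c, d}"
  proof
    show "V \<subseteq> X \<union> Y \<union> {a, b, c, d}" using other unfolding X_def Y_def T by blast
    show "X \<union> Y \<union> {a, b, c, d} \<subseteq> V" using ab cd by (auto simp: leaf_def X_def Y_def)
  qed
  have XY: "X \<inter> Y = {}"
    unfolding X_def Y_def using ne by auto
  have disj: "(X \<union> Y) \<inter> {a, b, c, d} = {}"
    by (auto simp: X_def Y_def T)
  have dist: "distinct [a, b, c, d]" using ne by simp
  have M_XY: "\<forall>v\<in>X. M v = {b, c, d}" "\<forall>v\<in>Y. M v = {a, b, d}" by (auto simp: X_def Y_def)
  have dc: "double_chain V R X Y a b c d"
    unfolding double_chain_def by (intro conjI V XY disj dist M_XY M4)
  have small4: "{p, q} \<noteq> V" for p q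
    using not_all_small[of "{p, q}"] by (simp add: card_insert_if)
  \<comment> \<open>An arc entering \<open>{a, b}\<close> ends in \<open>a\<close>. Its tail is not
    in \<open>T\<close>, because \<open>c\<close> and \<open>d\<close> miss \<open>a\<close>, so it
    lies in \<open>X\<close>. The argument for \<open>Y\<close> is symmetric.\<close>
  have X_ne: "X \<noteq> {}"
  proof -
    obtain x where x: "x \<in> V - {a, b}" "R x a \<or> R x b"
      using enter[of "{a, b}"] small4 ab by (auto simp: leaf_def)
    then have "R x a" using ab by (auto simp: leaf_def)
    then have "a \<notin> M x" by (simp add: nonout_def)
    then have "x \<notin> T" "M x = {b, c, d}" using x other[of x] M4 T by auto
    then show ?thesis using x by (auto simp: X_def)
  qed
  have Y_ne: "Y \<noteq> {}"
  proof -
    obtain x where x: "x \<in> V - {c, d}" "R x c \<or> R x d"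
      using enter[of "{c, d}"] small4 cd by (auto simp: leaf_def)
    then have "R x c" using cd by (auto simp: leaf_def)
    then have "c \<notin> M x" by (simp add: nonout_def)
    then have "x \<notin> T" "M x = {a, b, d}" using x other[of x] M4 T by auto
    then show ?thesis using x by (auto simp: Y_def)
  qed
  show ?thesis
  proof (intro conjI exI)
    show "double_chain V R X Y a b c d" by (fact dc)
  qed (fact sum_eq X_ne Y_ne)+
qed

end

section \<open>From outradius, connectedness and adjacency to the combinatorial setting\<close>

lemma (in digraph) far_of_outradius:
  assumes r: "outradius G = 3" and v: "v \<in> verts G"
  shows "\<exists>u\<in>verts G. u \<noteq> v \<and> \<not> v \<rightarrow>\<^bsub>G\<^esub> u \<and> (\<forall>w\<in>verts G. v \<rightarrow>\<^bsub>G\<^esub> w \<longrightarrow> \<not> w \<rightarrow>\<^bsub>G\<^esub> u)"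
proof -
  have "3 \<le> out_ecc G v"
    unfolding r[symmetric] outradius_def using v by (intro Min_le) auto
  moreover have "out_ecc G v \<in> dist_to G v ` verts G"
    unfolding out_ecc_def using v by (intro Max_in) auto
  ultimately obtain u where u: "u \<in> verts G" "3 \<le> dist_to G v u" by auto
  have len: "3 \<le> length p" if "apath v p u" for p
  proof -
    have "dist_to G v u \<le> enat (length p)"
      unfolding dist_to_def using that by (auto intro: INF_lower)
    then have "3 \<le> enat (length p)" using u(2) by (rule order_trans[rotated])
    then show ?thesis by (simp add: numeral_eq_enat)
  qed
  have "u \<noteq> v" using len[of "[]"] v by (auto simp: apath_Nil_iff)
  moreover have nvu: "\<not> v \<rightarrow>\<^bsub>G\<^esub> u"
  proof
    assume "v \<rightarrow>\<^bsub>G\<^esub> u"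
    then obtain e where "e \<in> arcs G" "tail G e = v" "head G e = u"
      by (auto simp: arcs_ends_def arc_to_ends_def)
    then show False using len[of "[e]"] u \<open>u \<noteq> v\<close> by (auto simp: apath_simps)
  qed
  moreover have "\<not> w \<rightarrow>\<^bsub>G\<^esub> u" if vw: "v \<rightarrow>\<^bsub>G\<^esub> w" for w
  proof
    assume wu: "w \<rightarrow>\<^bsub>G\<^esub> u"
    have "w \<noteq> u" "w \<noteq> v" using vw nvu wu by auto
    obtain e where e: "e \<in> arcs G" "tail G e = v" "head G e = w"
      using vw by (auto simp: arcs_ends_def arc_to_ends_def)
    obtain e' where e': "e' \<in> arcs G" "tail G e' = w" "head G e' = u"
      using wu by (auto simp: arcs_ends_def arc_to_ends_def)
    show False
      using len[of "[e, e']"] e e' u v \<open>u \<noteq> v\<close> \<open>w \<noteq> u\<close> \<open>w \<noteq> v\<close> by (auto simp: apath_simps)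
  qed
  ultimately show ?thesis using u(1) by blast
qed

lemma (in wf_digraph) enter_of_biconnected:
  assumes "biconnected G" "S \<subseteq> verts G" "S \<noteq> {}" "S \<noteq> verts G"
  shows "\<exists>x\<in>verts G - S. \<exists>y\<in>S. x \<rightarrow>\<^bsub>G\<^esub> y"
proof -
  obtain u v where uv: "u \<in> verts G - S" "v \<in> S" using assms by blast
  then have "u \<rightarrow>\<^sup>* v"
    using assms dist_to_finite_iff unfolding biconnected_def by blast
  then show ?thesis
    using uv
  \<comment> \<open>Walking along a path from \<open>u\<close> to \<open>v\<close>, the first arc
    whose head lies in \<open>S\<close> is the required one.\<close>
  proof (induction rule: converse_reachable_induct)
    case (step x y)
    then show ?case by (cases "y \<in> S") (auto dest: reachable_in_verts)
  qed auto
qed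

text \<open>Without multiple arcs, an arc is determined by its ends, so the vertex bijection induces
  the arc map.\<close>

lemma (in digraph) digraph_iso_with_projI:
  assumes bij: "bij_betw f (verts G) (pverts H)" and H: "parcs H \<subseteq> pverts H \<times> pverts H"
    and R: "\<And>u v. u \<in> verts G \<Longrightarrow> v \<in> verts G \<Longrightarrow> (f u, f v) \<in> parcs H \<longleftrightarrow> u \<rightarrow>\<^bsub>G\<^esub> v"
  shows "digraph_iso G (with_proj H)"
proof -
  define h where "h = \<lparr>iso_verts = f, iso_arcs = (\<lambda>e. (f (tail G e), f (head G e))),
    iso_head = snd, iso_tail = fst\<rparr>"
  have inj: "inj_on f (verts G)" using bij by (simp add: bij_betw_def)
  have "inj_on (iso_arcs h) (arcs G)"
  proof (rule inj_onI)
    fix e e' assume e: "e \<in> arcs G" "e' \<in> arcs G" "iso_arcs h e = iso_arcs h e'"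
    then have "arc_to_ends G e = arc_to_ends G e'"
      using inj by (auto simp: h_def arc_to_ends_def dest: inj_onD)
    then show "e = e'" using e no_multi_arcs by blast
  qed
  then have "digraph_isomorphism h"
    using inj wf_digraph_axioms by (simp add: digraph_isomorphism_def h_def)
  moreover have "iso_arcs h ` arcs G = parcs H"
  proof
    show "iso_arcs h ` arcs G \<subseteq> parcs H"
      using R by (auto simp: h_def dest: in_arcs_imp_in_arcs_ends)
    show "parcs H \<subseteq> iso_arcs h ` arcs G"
    proof
      fix p assume p: "p \<in> parcs H"
      then have "p \<in> f ` verts G \<times> f ` verts G" using H bij by (auto simp: bij_betw_def)
      then obtain u v where uv: "u \<in> verts G" "v \<in> verts G" "p = (f u, f v)" by auto
      then have "u \<rightarrow>\<^bsub>G\<^esub> v" using R p by blast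
      then show "p \<in> iso_arcs h ` arcs G"
        using uv by (auto simp: h_def arcs_ends_def arc_to_ends_def)
    qed
  qed
  then have "with_proj H = app_iso h G"
    using bij by (simp add: app_iso_def h_def with_proj_def bij_betw_def)
  ultimately show ?thesis unfolding digraph_iso_def by blast
qed

section \<open>The digraphs \<open>extremal_digraph n 3 s\<close> as double chains\<close>

lemma parcs_base_digraph:
  "(Vx i, Vx j) \<in> parcs (base_digraph r) \<longleftrightarrow> i \<in> {1..r} \<and> j \<in> {1..r} \<and> i \<noteq> j \<and> j \<le> i + 1"
  "(Wx i, Wx j) \<in> parcs (base_digraph r) \<longleftrightarrow> i \<in> {1..r} \<and> j \<in> {1..r} \<and> i \<noteq> j \<and> j \<le> i + 1"
  "(Vx i, Wx j) \<in> parcs (base_digraph r) \<longleftrightarrow> i \<in> {1..r} \<and> j = 1"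
  "(Wx i, Vx j) \<in> parcs (base_digraph r) \<longleftrightarrow> i \<in> {1..r} \<and> j = 1"
  by (auto simp: base_digraph_def)

lemma pverts_base_digraph_3: "pverts (base_digraph 3) = {Vx 1, Vx 2, Vx 3, Wx 1, Wx 2, Wx 3}"
proof -
  have "{1..3} = {1, 2, 3 :: nat}" by auto
  then show ?thesis unfolding base_digraph_def by auto
qed

lemma pverts_extremal_digraph:
  assumes "6 \<le> n"
  shows "pverts (extremal_digraph n 3 s) = Pair (Vx 1) ` {..<s} \<union> Pair (Wx 1) ` {..<n - 4 - s} \<union>
    {(Vx 2, 0), (Vx 3, 0), (Wx 2, 0), (Wx 3, 0)}"
  using assms by (auto simp: extremal_digraph_def clique_blowup_def pverts_base_digraph_3 split: if_splits)

lemma parcs_extremal_digraph: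
  "((x, i), (y, j)) \<in> parcs (extremal_digraph n 3 s) \<longleftrightarrow>
    (x, i) \<in> pverts (extremal_digraph n 3 s) \<and> (y, j) \<in> pverts (extremal_digraph n 3 s) \<and>
    ((x, y) \<in> parcs (base_digraph 3) \<or> x = y \<and> i \<noteq> j)"
  unfolding extremal_digraph_def clique_blowup_def base_digraph_def by auto

text \<open>Distinct copies of one base vertex are adjacent, so non-adjacency can be read off in the
  base digraph.\<close>

lemma nonout_extremal_digraph:
  assumes "(x, i) \<in> pverts (extremal_digraph n 3 s)"
  shows "nonout (pverts (extremal_digraph n 3 s)) (\<lambda>u v. (u, v) \<in> parcs (extremal_digraph n 3 s)) (x, i) =
    {u \<in> pverts (extremal_digraph n 3 s). fst u \<noteq> x \<and> (x, fst u) \<notin> parcs (base_digraph 3)}"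
proof -
  have "(x, x) \<notin> parcs (base_digraph 3)" by (cases x) (simp_all add: parcs_base_digraph)
  then show ?thesis
    using assms unfolding nonout_def by (auto simp: parcs_extremal_digraph)
qed

lemma double_chain_extremal_digraph:
  assumes "6 \<le> n"
  shows "double_chain (pverts (extremal_digraph n 3 s)) (\<lambda>u v. (u, v) \<in> parcs (extremal_digraph n 3 s))
    (Pair (Vx 1) ` {..<s}) (Pair (Wx 1) ` {..<n - 4 - s}) (Vx 2, 0) (Vx 3, 0) (Wx 2, 0) (Wx 3, 0)"
proof -
  note P = pverts_extremal_digraph[OF assms]
  let ?N = "\<lambda>x. {u \<in> pverts (extremal_digraph n 3 s). fst u \<noteq> x \<and> (x, fst u) \<notin> parcs (base_digraph 3)}"
  have N: "?N (Vx 1) = {(Vx 3, 0), (Wx 2, 0), (Wx 3, 0)}" "?N (Wx 1) = {(Vx 2, 0), (Vx 3, 0), (Wx 3, 0)}"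
    "?N (Vx 2) = {(Wx 2, 0), (Wx 3, 0)}" "?N (Vx 3) = {(Wx 2, 0), (Wx 3, 0)}"
    "?N (Wx 2) = {(Vx 2, 0), (Vx 3, 0)}" "?N (Wx 3) = {(Vx 2, 0), (Vx 3, 0)}"
    by (safe; auto simp: P parcs_base_digraph)+
  have v: "(Vx 1, i) \<in> pverts (extremal_digraph n 3 s)" if "i < s" for i using that by (simp add: P)
  have w: "(Wx 1, i) \<in> pverts (extremal_digraph n 3 s)" if "i < n - 4 - s" for i using that by (simp add: P)
  show ?thesis
    unfolding double_chain_def
  proof (intro conjI ballI)
    fix p assume "p \<in> Pair (Vx 1) ` {..<s}"
    then obtain i where "p = (Vx 1, i)" "i < s" by auto
    then show "nonout (pverts (extremal_digraph n 3 s)) (\<lambda>u v. (u, v) \<in> parcs (extremal_digraph n 3 s)) p =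
        {(Vx 3, 0), (Wx 2, 0), (Wx 3, 0)}"
      by (simp only: nonout_extremal_digraph[OF v] N)
  next
    fix p assume "p \<in> Pair (Wx 1) ` {..<n - 4 - s}"
    then obtain i where "p = (Wx 1, i)" "i < n - 4 - s" by auto
    then show "nonout (pverts (extremal_digraph n 3 s)) (\<lambda>u v. (u, v) \<in> parcs (extremal_digraph n 3 s)) p =
        {(Vx 2, 0), (Vx 3, 0), (Wx 3, 0)}"
      by (simp only: nonout_extremal_digraph[OF w] N)
  qed (rule trans[OF nonout_extremal_digraph], simp add: P, rule N | (auto simp: P)[1])+
qed

theorem theorem4p1:
  fixes D :: "('a, 'b) pre_digraph" and n :: nat
  assumes "n \<ge> 6"
    and "digraph D"
    and "biconnected D"
    and "card (verts D) = n"
    and "outradius D = 3"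
  shows "card (arcs D) \<le> (n - 2)\<^sup>2 \<and>
    (card (arcs D) = (n - 2)\<^sup>2 \<longleftrightarrow>
      (\<exists>s::nat. 1 \<le> s \<and> real s \<le> (real n - 4) / 2 \<and>
        digraph_iso D (with_proj (extremal_digraph n 3 s))))"
proof -
  interpret digraph D by fact
  let ?R = "\<lambda>u v. u \<rightarrow>\<^bsub>D\<^esub> v"
  interpret outradius_ge_3 "verts D" ?R
  proof
    show "\<not> v \<rightarrow>\<^bsub>D\<^esub> v" for v by (auto dest: adj_not_same)
  qed (use assms far_of_outradius enter_of_biconnected in auto)
  \<comment> \<open>This states that \<open>(n - 2)\<^sup>2\<close> is \<open>n * (n - 1)\<close>
    minus \<open>3 * n - 4\<close>, arranged to avoid truncated subtraction.\<close>
  have square: "(n - 2)\<^sup>2 + 3 * n = n * (n - 1) + 4"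
  proof -
    obtain k where "n = k + 6" using \<open>n \<ge> 6\<close> by (metis le_add_diff_inverse2)
    then show ?thesis by (simp add: power2_eq_square algebra_simps)
  qed
  have "card (arcs_ends D) = card (arcs D)"
    unfolding arcs_ends_def by (rule card_image) (rule inj_on_arc_to_ends)
  moreover have sub: "arcs_ends D \<subseteq> verts D \<times> verts D"
    by (auto simp: arcs_ends_def arc_to_ends_def)
  ultimately have count: "card (arcs D) + (\<Sum>v\<in>verts D. card (M v)) = n * (n - 1)"
    using card_arcs_plus_nonout[of "verts D" "arcs_ends D"] sub assms(4) irrefl by simp
  \<comment> \<open>If the bound failed, there would be fewer than \<open>3 * n - 4\<close>
    non-arcs, whereas \<open>sum_card_M\<close> then gives exactly that number.\<close>
  have le: "card (arcs D) \<le> (n - 2)\<^sup>2"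
    using sum_card_M count square assms(4) by fastforce
  have "\<exists>s\<ge>1. real s \<le> (real n - 4) / 2 \<and> digraph_iso D (with_proj (extremal_digraph n 3 s))"
    if eq: "card (arcs D) = (n - 2)\<^sup>2"
  proof -
    have "\<exists>X Y a b c d. double_chain (verts D) ?R X Y a b c d \<and> X \<noteq> {} \<and> Y \<noteq> {}"
      using sum_card_M count square eq assms(4) by auto
    \<comment> \<open>The swap arranges that \<open>X\<close> is the smaller clique; its size serves
      as \<open>s\<close>.\<close>
    then obtain X Y a b c d where dc: "double_chain (verts D) ?R X Y a b c d"
      and ne: "X \<noteq> {}" and le: "card X \<le> card Y"
      using double_chain_swap by (metis nle_le)
    have n: "n = card X + card Y + 4"
      using sum_card_nonout_double_chain(2)[OF dc] assms(4) by simp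
    have "finite X" using dc finite_verts unfolding double_chain_def by (metis finite_Un)
    let ?H = "extremal_digraph n 3 (card X)"
    interpret H: digraph "with_proj ?H" by (rule digraph_extremal)
    obtain f where f: "bij_betw f (verts D) (pverts ?H)"
      "\<And>u v. u \<in> verts D \<Longrightarrow> v \<in> verts D \<Longrightarrow> (f u, f v) \<in> parcs ?H \<longleftrightarrow> u \<rightarrow>\<^bsub>D\<^esub> v"
    proof (rule double_chain_iso[OF dc double_chain_extremal_digraph[OF \<open>n \<ge> 6\<close>, of "card X"]])
      show "\<not> u \<rightarrow>\<^bsub>D\<^esub> u" for u by (rule irrefl)
      show "(p, p) \<notin> parcs ?H" for p
        using H.no_loops[of "(p, p)"] by auto
    qed (use H.finite_verts n in \<open>auto simp: card_image inj_on_def\<close>)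
    have "parcs ?H \<subseteq> pverts ?H \<times> pverts ?H"
      by (auto simp: parcs_extremal_digraph)
    then have "digraph_iso D (with_proj ?H)"
      using f by (intro digraph_iso_with_projI)
    moreover have "real (card X) \<le> (real n - 4) / 2" using n le by simp
    moreover have "card X \<ge> 1" using ne \<open>finite X\<close> by (simp add: Suc_le_eq card_gt_0_iff)
    ultimately show ?thesis by blast
  qed
  moreover have "card (arcs D) = (n - 2)\<^sup>2"
    if iso: "digraph_iso D (with_proj (extremal_digraph n 3 s))" for s
  proof -
    let ?H = "extremal_digraph n 3 s"
    interpret H: digraph "with_proj ?H" by (rule digraph_extremal)
    \<comment> \<open>The order of \<open>?H\<close> comes from the isomorphism; its arcs are then
      counted through the double chain.\<close>
    have cards: "card (arcs D) = card (parcs ?H)" "card (pverts ?H) = n"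
      using iso assms(4) card_arcs_iso card_verts_iso
      by (auto simp: digraph_iso_def app_iso_def with_proj_def)
    have "card (parcs ?H) + (\<Sum>v\<in>pverts ?H. card (nonout (pverts ?H) (\<lambda>u v. (u, v) \<in> parcs ?H) v)) =
        card (pverts ?H) * (card (pverts ?H) - 1)"
    proof (rule card_arcs_plus_nonout)
      show "(p, p) \<notin> parcs ?H" for p
        using H.no_loops[of "(p, p)"] by auto
    qed (use H.finite_verts in \<open>auto simp: parcs_extremal_digraph\<close>)
    then show ?thesis
      using sum_card_nonout_double_chain(1)[OF double_chain_extremal_digraph[OF \<open>n \<ge> 6\<close>, of s]]
        H.finite_verts cards square by auto
  qed
  ultimately show ?thesis using le by blast
qed

end
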